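(* Let $S$ be an intra-regular AG-groupoid with left identity and let $A=(\mu_A,\gamma_A)$ be an intuitionistic fuzzy set of $S$. Then $A$ is an intuitionistic fuzzy left ideal of $S$ if and only if $A$ is an intuitionistic fuzzy right ideal of $S$.
   Context: An AG-groupoid is a non-empty set $S$ with a binary operation satisfying the left invertive law $(ab)c=(cb)a$ for all $a,b,c\in S$ (no associativity is assumed); $a^2$ denotes $aa$. A left identity is an element $e\in S$ with $ea=a$ for all $a\in S$. $S$ is intra-regular if for every $a\in S$ there are $x,y\in S$ with $a=(xa^2)y$. An intuitionistic fuzzy set (IFS) of $S$ is a pair $A=(\mu_A,\gamma_A)$ of functions $\mu_A,\gamma_A:S\to[0,1]$ with $0\le \mu_A(x)+\gamma_A(x)\le 1$ for all $x\in S$. An IFS $A$ is an intuitionistic fuzzy left ideal if $\mu_A(xy)\ge\mu_A(y)$ and $\gamma_A(xy)\le\gamma_A(y)$ for all $x,y\in S$, and an intuitionistic fuzzy right ideal if $\mu_A(xy)\ge\mu_A(x)$ and $\gamma_A(xy)\le\gamma_A(x)$ for all $x,y\in S$. *)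

theory Defs
  imports Complex_Main
begin

locale ag_groupoid =
  fixes S :: "'a set" and mult :: "'a \<Rightarrow> 'a \<Rightarrow> 'a" (infixl "\<cdot>" 70)
  assumes nonempty: "S \<noteq> {}"
    and closed: "a \<in> S \<Longrightarrow> b \<in> S \<Longrightarrow> a \<cdot> b \<in> S"
    and left_invertive: "a \<in> S \<Longrightarrow> b \<in> S \<Longrightarrow> c \<in> S \<Longrightarrow> (a \<cdot> b) \<cdot> c = (c \<cdot> b) \<cdot> a"

definition left_identity :: "'a set \<Rightarrow> ('a \<Rightarrow> 'a \<Rightarrow> 'a) \<Rightarrow> 'a \<Rightarrow> bool" where
  "left_identity S mult e \<longleftrightarrow> e \<in> S \<and> (\<forall>a\<in>S. mult e a = a)"

definition intra_regular :: "'a set \<Rightarrow> ('a \<Rightarrow> 'a \<Rightarrow> 'a) \<Rightarrow> bool" where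
  "intra_regular S mult \<longleftrightarrow>
     (\<forall>a\<in>S. \<exists>x\<in>S. \<exists>y\<in>S. a = mult (mult x (mult a a)) y)"

(* A pair (\<mu>, \<gamma>) of maps S \<rightarrow> [0,1] is given by total functions whose values
   outside S are irrelevant: every condition below is restricted to S. *)

type_synonym 'a fuzzy_pair = "('a \<Rightarrow> real) \<times> ('a \<Rightarrow> real)"

definition intuitionistic_fuzzy_set :: "'a set \<Rightarrow> 'a fuzzy_pair \<Rightarrow> bool" where
  "intuitionistic_fuzzy_set S = (\<lambda>(\<mu>, \<gamma>).
     \<forall>x\<in>S. \<mu> x \<in> {0..1} \<and> \<gamma> x \<in> {0..1} \<and> 0 \<le> \<mu> x + \<gamma> x \<and> \<mu> x + \<gamma> x \<le> 1)"

definition intuitionistic_fuzzy_left_ideal ::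
  "'a set \<Rightarrow> ('a \<Rightarrow> 'a \<Rightarrow> 'a) \<Rightarrow> 'a fuzzy_pair \<Rightarrow> bool" where
  "intuitionistic_fuzzy_left_ideal S mult A \<longleftrightarrow> intuitionistic_fuzzy_set S A \<and>
     (case A of (\<mu>, \<gamma>) \<Rightarrow>
        \<forall>x\<in>S. \<forall>y\<in>S. \<mu> (mult x y) \<ge> \<mu> y \<and> \<gamma> (mult x y) \<le> \<gamma> y)"

definition intuitionistic_fuzzy_right_ideal ::
  "'a set \<Rightarrow> ('a \<Rightarrow> 'a \<Rightarrow> 'a) \<Rightarrow> 'a fuzzy_pair \<Rightarrow> bool" where
  "intuitionistic_fuzzy_right_ideal S mult A \<longleftrightarrow> intuitionistic_fuzzy_set S A \<and>
     (case A of (\<mu>, \<gamma>) \<Rightarrow>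
        \<forall>x\<in>S. \<forall>y\<in>S. \<mu> (mult x y) \<ge> \<mu> x \<and> \<gamma> (mult x y) \<le> \<gamma> x)"

end

theory Submission
  imports Defs
begin

text \<open>The left invertive law trades multiplications on one side for multiplications on the
  other. Intra-regularity, \<open>a = (x(aa))y\<close>, gives \<open>ab = (by)(x(aa))\<close>, so
  \<open>ab\<close> arises from \<open>a\<close> by left multiplications alone. A left identity
  gives \<open>ab = (ea)b = (ba)e\<close>, so \<open>ab\<close> arises from \<open>b\<close> by
  right multiplications alone. Hence a function that never decreases under multiplication on one
  side never decreases under the other: \<open>right_monotone_if_left_monotone\<close> and
  \<open>left_monotone_if_right_monotone\<close>. The theorem applies this to \<mu> and to
  -\<gamma>.\<close>

context ag_groupoid
begin

text \<open>Putting \<open>e\<close> in front of \<open>a\<close> makes the left invertive law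
  applicable; it exchanges \<open>e\<close> and \<open>b\<close>.\<close>

lemma mult_eq_mult_mult_left_identity:
  assumes "left_identity S mult e" "a \<in> S" "b \<in> S"
  shows "a \<cdot> b = (b \<cdot> a) \<cdot> e"
proof -
  have "a \<cdot> b = (e \<cdot> a) \<cdot> b"
    using assms by (simp add: left_identity_def)
  also have "\<dots> = (b \<cdot> a) \<cdot> e"
    using assms by (intro left_invertive) (auto simp: left_identity_def)
  finally show ?thesis .
qed

text \<open>Once \<open>a\<close> is expanded by intra-regularity, the left invertive law carries
  \<open>b\<close> to the front, with \<open>u = b \<cdot> y\<close>.\<close>

lemma intra_regular_mult_left_multiple:
  assumes "intra_regular S mult" "a \<in> S" "b \<in> S"
  obtains u x where "u \<in> S" "x \<in> S" "a \<cdot> b = u \<cdot> (x \<cdot> (a \<cdot> a))"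
proof -
  obtain x y where xy: "x \<in> S" "y \<in> S" "a = (x \<cdot> (a \<cdot> a)) \<cdot> y"
    using assms unfolding intra_regular_def by blast
  have "a \<cdot> b = ((x \<cdot> (a \<cdot> a)) \<cdot> y) \<cdot> b"
    using xy(3) by simp
  also have "\<dots> = (b \<cdot> y) \<cdot> (x \<cdot> (a \<cdot> a))"
    using xy(1,2) assms(2,3) by (intro left_invertive closed)
  finally show ?thesis
    using that closed[OF assms(3) xy(2)] xy(1) by simp
qed

text \<open>Values of \<open>f\<close> grow along the chain \<open>a\<close>,
  \<open>a \<cdot> a\<close>, \<open>x \<cdot> (a \<cdot> a)\<close>,
  \<open>u \<cdot> (x \<cdot> (a \<cdot> a))\<close>, each a left multiple of its
  predecessor.\<close>

lemma right_monotone_if_left_monotone: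
  fixes f :: "'a \<Rightarrow> 'b::preorder"
  assumes "intra_regular S mult"
    and left: "\<And>x y. x \<in> S \<Longrightarrow> y \<in> S \<Longrightarrow> f y \<le> f (x \<cdot> y)"
    and ab: "a \<in> S" "b \<in> S"
  shows "f a \<le> f (a \<cdot> b)"
proof -
  obtain u x where ux: "u \<in> S" "x \<in> S" "a \<cdot> b = u \<cdot> (x \<cdot> (a \<cdot> a))"
    using intra_regular_mult_left_multiple[OF assms(1) ab] .
  have "f a \<le> f (a \<cdot> a)"
    using ab by (intro left)
  also have "\<dots> \<le> f (x \<cdot> (a \<cdot> a))"
    using ux(1,2) ab by (intro left closed)
  also have "\<dots> \<le> f (a \<cdot> b)"
    unfolding ux(3) using ux(1,2) ab by (intro left closed)
  finally show ?thesis .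
qed

lemma left_monotone_if_right_monotone:
  fixes f :: "'a \<Rightarrow> 'b::preorder"
  assumes e: "left_identity S mult e"
    and right: "\<And>x y. x \<in> S \<Longrightarrow> y \<in> S \<Longrightarrow> f x \<le> f (x \<cdot> y)"
    and ab: "a \<in> S" "b \<in> S"
  shows "f b \<le> f (a \<cdot> b)"
proof -
  have "f b \<le> f (b \<cdot> a)"
    using ab by (intro right)
  also have "\<dots> \<le> f ((b \<cdot> a) \<cdot> e)"
    using ab e unfolding left_identity_def by (intro right closed) simp_all
  finally show ?thesis
    using mult_eq_mult_mult_left_identity[OF e ab] by simp
qed

end

theorem lemma11:
  fixes S :: "'a set" and mult :: "'a \<Rightarrow> 'a \<Rightarrow> 'a" and A :: "'a fuzzy_pair"
  assumes "ag_groupoid S mult"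
    and "\<exists>e. left_identity S mult e"
    and "intra_regular S mult"
    and "intuitionistic_fuzzy_set S A"
  shows "intuitionistic_fuzzy_left_ideal S mult A \<longleftrightarrow> intuitionistic_fuzzy_right_ideal S mult A"
proof -
  interpret ag_groupoid S mult by fact
  obtain e where e: "left_identity S mult e"
    using assms(2) by blast
  obtain \<mu> \<gamma> where A: "A = (\<mu>, \<gamma>)"
    by (cases A)
  have iff: "(\<forall>x\<in>S. \<forall>y\<in>S. f y \<le> f (mult x y)) \<longleftrightarrow> (\<forall>x\<in>S. \<forall>y\<in>S. f x \<le> f (mult x y))"
    for f :: "'a \<Rightarrow> real"
    by (metis right_monotone_if_left_monotone[OF assms(3), of f]
        left_monotone_if_right_monotone[OF e, of f])
  show ?thesis
    \<comment> \<open>Negation turns the reversed inequality for \<gamma> into the form of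
      \<open>iff\<close>; \<open>neg_le_iff_le\<close> then removes the signs.\<close>
    using assms(4) iff[of \<mu>] iff[of "\<lambda>x. - \<gamma> x"]
    unfolding intuitionistic_fuzzy_left_ideal_def intuitionistic_fuzzy_right_ideal_def A
      prod.case neg_le_iff_le
    by blast
qed

end
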